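(* Let $\alpha:[0,\infty)\to(0,1)$ be a right-continuous piecewise constant function and let $\{S^{\alpha(t)}(t)\}_{t\ge 0}$ be the variable-order stable subordinator with index $\alpha(\cdot)$. Then for every $t\ge 0$ and every $\lambda\ge 0$, $$\mathbb{E}\left[e^{-\lambda S^{\alpha(t)}(t)}\right]=\exp\left(-\int_0^t \lambda^{\alpha(s)}\,ds\right).$$
   Context: Piecewise constant index: $\alpha:[0,\infty)\to(0,1)$ is right-continuous and piecewise constant, with finitely many pieces on every bounded interval. That is, there are breakpoints $0=s_0<s_1<s_2<\cdots$ (either finitely many, with the last interval extending to $\infty$, or infinitely many with $s_j\to\infty$) and constants $\alpha_j\in(0,1)$ such that $\alpha(t)=\alpha_j$ for all $t\in[s_{j-1},s_j)$. Classical stable subordinator: for $a\in(0,1)$, an $a$-stable subordinator $\{S^{a}(t)\}_{t\ge0}$ is a nondecreasing Lévy process started at $0$ with $\mathbb{E}[e^{-\lambda S^{a}(t)}]=e^{-t\lambda^{a}}$ for all $t\ge0$, $\lambda\ge0$. Variable-order stable subordinator (VOSS) with index $\alpha(\cdot)$: take independent classical stable subordinators $S^{\alpha_1},S^{\alpha_2},\ldots$, one for each interval $[s_{j-1},s_j)$, the $j$-th having index $\alpha_j$ (subordinators attached to different intervals are independent even if their indices coincide). For $t\ge0$ let $k$ be such that $s_{k-1}\le t<s_k$ (with $s_k=\infty$ if the $k$-th interval is the last one). Then $$S^{\alpha(t)}(t)=\sum_{j=1}^{k-1}S^{\alpha_j}(s_j-s_{j-1})+S^{\alpha_k}(t-s_{k-1}).$$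 *)

theory Defs
  imports "HOL-Probability.Probability"
begin

text \<open>
  The number \<open>N\<close> of pieces is at least 1 and possibly infinite. The left endpoints are
  \<open>s 0, s 1, \<dots>\<close>, and piece \<open>j\<close> (with \<open>1 \<le> j \<le> N\<close>) is \<open>[s (j - 1), s j)\<close>, except that the last
  piece, if there is one, extends to infinity. Hence \<open>s j\<close> is meaningful only for \<open>j < N\<close>.
\<close>

definition pieces :: "enat \<Rightarrow> nat set" where
  "pieces N = {j. 1 \<le> j \<and> enat j \<le> N}"

definition piece :: "enat \<Rightarrow> (nat \<Rightarrow> real) \<Rightarrow> nat \<Rightarrow> real set" where
  "piece N s j = (if enat j = N then {s (j - 1)..} else {s (j - 1)..<s j})"

definition breakpoints :: "enat \<Rightarrow> (nat \<Rightarrow> real) \<Rightarrow> bool" where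
  "breakpoints N s \<longleftrightarrow>
     1 \<le> N \<and> s 0 = 0 \<and> (\<forall>i j. i < j \<and> enat j < N \<longrightarrow> s i < s j) \<and>
     (N = \<infinity> \<longrightarrow> filterlim s at_top sequentially)"

text \<open>Only the values of \<open>\<alpha>\<close> on \<open>[0, \<infinity>)\<close> are constrained. Right-continuity is built into the
  half-open pieces. Adjacent pieces may carry the same constant.\<close>

definition piecewise_constant_index ::
    "(real \<Rightarrow> real) \<Rightarrow> enat \<Rightarrow> (nat \<Rightarrow> real) \<Rightarrow> (nat \<Rightarrow> real) \<Rightarrow> bool" where
  "piecewise_constant_index \<alpha> N s a \<longleftrightarrow>
     breakpoints N s \<and>
     (\<forall>j\<in>pieces N. 0 < a j \<and> a j < 1 \<and> (\<forall>t\<in>piece N s j. \<alpha> t = a j))"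

text \<open>Processes are indexed by \<open>real\<close>; only times in \<open>[0, \<infinity>)\<close> matter. Sample paths are not
  required to be cadlag.\<close>

definition levy_process :: "'a measure \<Rightarrow> (real \<Rightarrow> 'a \<Rightarrow> real) \<Rightarrow> bool" where
  "levy_process M X \<longleftrightarrow>
     prob_space M \<and>
     (\<forall>t\<ge>0. X t \<in> borel_measurable M) \<and>
     (AE \<omega> in M. X 0 \<omega> = 0) \<and>
     (\<forall>(n::nat) \<tau>. 0 \<le> \<tau> 0 \<and> (\<forall>i<n. \<tau> i \<le> \<tau> (Suc i)) \<longrightarrow>
        prob_space.indep_vars M (\<lambda>_. borel) (\<lambda>i \<omega>. X (\<tau> (Suc i)) \<omega> - X (\<tau> i) \<omega>) {..<n}) \<and>
     (\<forall>u\<ge>0. \<forall>h\<ge>0. distr M borel (\<lambda>\<omega>. X (u + h) \<omega> - X u \<omega>) = distr M borel (X h)) \<and>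
     (\<forall>t\<ge>0. \<forall>\<epsilon>>0.
        ((\<lambda>u. measure M {\<omega> \<in> space M. \<bar>X u \<omega> - X t \<omega>\<bar> > \<epsilon>}) \<longlongrightarrow> 0) (at t within {0..}))"

definition stable_subordinator :: "'a measure \<Rightarrow> real \<Rightarrow> (real \<Rightarrow> 'a \<Rightarrow> real) \<Rightarrow> bool" where
  "stable_subordinator M a X \<longleftrightarrow>
     levy_process M X \<and>
     (AE \<omega> in M. mono_on {0..} (\<lambda>t. X t \<omega>)) \<and>
     (\<forall>t\<ge>0. \<forall>l\<ge>0. (LINT \<omega>|M. exp (- l * X t \<omega>)) = exp (- t * l powr a))"

text \<open>The subordinators are independent as processes, that is, as random elements of the product
  space of functions on \<open>[0, \<infinity>)\<close>.\<close>

definition independent_stable_subordinators ::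
    "'a measure \<Rightarrow> enat \<Rightarrow> (nat \<Rightarrow> real) \<Rightarrow> (nat \<Rightarrow> real \<Rightarrow> 'a \<Rightarrow> real) \<Rightarrow> bool" where
  "independent_stable_subordinators M N a S \<longleftrightarrow>
     prob_space M \<and>
     (\<forall>j\<in>pieces N. stable_subordinator M (a j) (S j)) \<and>
     prob_space.indep_vars M (\<lambda>_. Pi\<^sub>M {0..} (\<lambda>_. borel))
       (\<lambda>j \<omega>. \<lambda>t\<in>{0..}. S j t \<omega>) (pieces N)"

definition piece_index :: "enat \<Rightarrow> (nat \<Rightarrow> real) \<Rightarrow> real \<Rightarrow> nat" where
  "piece_index N s t = (THE k. k \<in> pieces N \<and> t \<in> piece N s k)"

definition voss ::
    "enat \<Rightarrow> (nat \<Rightarrow> real) \<Rightarrow> (nat \<Rightarrow> real \<Rightarrow> 'a \<Rightarrow> real) \<Rightarrow> real \<Rightarrow> 'a \<Rightarrow> real" where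
  "voss N s S t \<omega> =
     (let k = piece_index N s t
      in (\<Sum>j=1..<k. S j (s j - s (j - 1)) \<omega>) + S k (t - s (k - 1)) \<omega>)"

lemma ex1_piece:
  assumes "breakpoints N s" "0 \<le> t"
  shows "\<exists>!k. k \<in> pieces N \<and> t \<in> piece N s k"
proof -
  define P where "P k \<longleftrightarrow> enat k < N \<and> s k \<le> t" for k
  have mono: "s i < s j" if "i < j" "enat j < N" for i j
    using assms(1) that unfolding breakpoints_def by blast
  have "P 0"
    using assms by (auto simp: breakpoints_def P_def enat_0 zero_less_iff_neq_zero)
  have bound: "\<exists>b. \<forall>k. P k \<longrightarrow> k \<le> b"
  proof (cases N)
    case (enat n)
    then show ?thesis by (intro exI[of _ n]) (auto simp: P_def)
  next
    case infinity
    then have "eventually (\<lambda>k. t < s k) sequentially"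
      using assms(1) unfolding breakpoints_def filterlim_at_top_dense by blast
    then obtain b where "\<forall>k\<ge>b. t < s k" by (auto simp: eventually_sequentially)
    then show ?thesis by (metis P_def linorder_not_less nle_le)
  qed
  then obtain b where b: "\<forall>k. P k \<longrightarrow> k \<le> b" by blast
  define m where "m = (GREATEST k. P k)"
  have m: "P m" unfolding m_def using GreatestI_nat[of P 0 b] \<open>P 0\<close> b by blast
  have m_max: "k \<le> m" if "P k" for k unfolding m_def using Greatest_le_nat[of P k b] that b by blast
  show ?thesis
  proof (rule ex1I[of _ "Suc m"])
    have "t < s (Suc m)" if "enat (Suc m) \<noteq> N"
    proof -
      have "enat (Suc m) < N" using m that by (cases N) (auto simp: P_def)
      with m_max[of "Suc m"] show ?thesis by (force simp: P_def not_less)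
    qed
    moreover have "enat (Suc m) \<le> N" using m by (cases N) (auto simp: P_def)
    ultimately show "Suc m \<in> pieces N \<and> t \<in> piece N s (Suc m)"
      using m by (auto simp: pieces_def piece_def P_def)
  next
    fix k assume k: "k \<in> pieces N \<and> t \<in> piece N s k"
    then obtain i where i: "k = Suc i" by (cases k) (auto simp: pieces_def)
    have iN: "enat i < N" using k i by (cases N) (auto simp: pieces_def)
    have "s i \<le> t" using k i by (auto simp: piece_def split: if_splits)
    then have "i \<le> m" using m_max iN by (simp add: P_def)
    moreover have "\<not> i < m"
    proof
      assume "i < m"
      then have "enat (Suc i) \<le> enat m" by simp
      also have "enat m < N" using m by (simp add: P_def)
      finally have "enat (Suc i) < N" .
      then have "enat (Suc i) \<noteq> N" by simp
      then have "t < s (Suc i)" using k i by (simp add: piece_def)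
      moreover have "s (Suc i) \<le> s m"
        using mono[of "Suc i" m] \<open>i < m\<close> m by (cases "Suc i = m") (auto simp: P_def)
      ultimately show False using m by (auto simp: P_def)
    qed
    ultimately show "k = Suc m" using i by simp
  qed
qed

end

theory Submission
  imports Defs
begin

text \<open>
  Fix \<open>t\<close> and let \<open>k\<close> be the piece containing it. Cutting \<open>[0, t]\<close> along the pieces leaves the
  intervals \<open>[s (j - 1), s j)\<close> for \<open>j < k\<close> and \<open>[s (k - 1), t]\<close>. Let \<open>h j\<close> denote their lengths;
  these are exactly the times at which the process samples the subordinators, so its value at
  \<open>t\<close> is \<open>\<Sum>j=1..k. S j (h j)\<close>.

  On the probabilistic side, independence of the subordinators turns the Laplace transform of
  this sum into the product of the transforms \<open>exp (- h j * l powr a j)\<close>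
  (\<open>laplace_transform_sum\<close>). On the analytic side, \<open>l powr \<alpha> u\<close> is a step function on \<open>[0, t]\<close>
  taking the value \<open>l powr a j\<close> on a set of measure \<open>h j\<close>, so its integral is
  \<open>\<Sum>j=1..k. h j * l powr a j\<close> (\<open>integral_powr_index\<close>). The exponential of a sum is the product
  of the exponentials.
\<close>

text \<open>
  The length \<open>h j\<close> from above. It is given by this formula, rather than as a measure, because the
  same number is the argument at which the process evaluates the \<open>j\<close>-th subordinator; that it is
  also the measure of \<open>[0, t]\<close> intersected with piece \<open>j\<close> is \<open>measure_piece_inter\<close>. The values are
  meaningful for \<open>1 \<le> j \<le> piece_index N s t\<close>.
\<close>

definition time_in_piece :: "enat \<Rightarrow> (nat \<Rightarrow> real) \<Rightarrow> real \<Rightarrow> nat \<Rightarrow> real" where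
  "time_in_piece N s t j =
     (if j < piece_index N s t then s j - s (j - 1) else t - s (j - 1))"

lemma piece_index:
  assumes "breakpoints N s" "0 \<le> t"
  shows "piece_index N s t \<in> pieces N" "t \<in> piece N s (piece_index N s t)"
  using theI'[OF ex1_piece[OF assms]] by (simp_all add: piece_index_def)

lemma piece_index_unique:
  assumes "breakpoints N s" "0 \<le> t" "k \<in> pieces N" "t \<in> piece N s k"
  shows "k = piece_index N s t"
  using ex1_piece[OF assms(1,2)] piece_index[OF assms(1,2)] assms(3,4) by blast

lemma breakpoints_le:
  assumes "breakpoints N s" "i \<le> j" "enat j < N"
  shows "s i \<le> s j"
proof (cases "i = j")
  case False
  then have "i < j" using assms(2) by simp
  then have "s i < s j" using assms(1,3) unfolding breakpoints_def by blast
  then show ?thesis by simp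
qed simp

lemma pieces_pred_less:
  assumes "j \<in> pieces N"
  shows "enat (j - 1) < N"
  using assms by (cases N) (auto simp: pieces_def)

lemma pieces_downward:
  assumes "k \<in> pieces N" "1 \<le> j" "j \<le> k"
  shows "j \<in> pieces N"
  using assms by (cases N) (auto simp: pieces_def)

lemma piece_start_le:
  assumes "t \<in> piece N s k"
  shows "s (k - 1) \<le> t"
  using assms by (auto simp: piece_def split: if_splits)

lemma piece_index_mono:
  assumes bp: "breakpoints N s" and "0 \<le> u" "u \<le> t"
  shows "piece_index N s u \<le> piece_index N s t"
proof (rule ccontr)
  let ?p = "piece_index N s u" and ?k = "piece_index N s t"
  assume "\<not> ?p \<le> ?k"
  then have less: "?k \<le> ?p - 1" by simp
  have p: "?p \<in> pieces N" "u \<in> piece N s ?p" using piece_index[OF bp] assms by auto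
  have k: "t \<in> piece N s ?k" using piece_index[OF bp] assms by auto
  have last: "enat (?p - 1) < N" using pieces_pred_less[OF p(1)] .
  have "enat ?k \<noteq> N" using less last by (metis enat_ord_simps(1) leD)
  then have "t < s ?k" using k by (simp add: piece_def)
  also have "\<dots> \<le> s (?p - 1)" using breakpoints_le[OF bp less last] .
  also have "\<dots> \<le> u" using piece_start_le[OF p(2)] .
  finally show False using assms(3) by linarith
qed

text \<open>
  A piece before the one containing \<open>t\<close> ends at or before \<open>t\<close>, and in particular is not the
  unbounded last piece, so it lies in \<open>[0, t]\<close> entirely; only the piece containing \<open>t\<close> is cut.
\<close>

lemma piece_inter_initial_interval:
  assumes bp: "breakpoints N s" and t: "0 \<le> t" and j: "1 \<le> j" "j \<le> piece_index N s t"
  shows "piece N s j \<inter> {0..t} =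
    (if j < piece_index N s t then {s (j - 1)..<s j} else {s (j - 1)..t})"
    and "0 \<le> time_in_piece N s t j"
proof -
  let ?k = "piece_index N s t"
  note k = piece_index[OF bp t]
  have last: "enat (?k - 1) < N" using pieces_pred_less[OF k(1)] .
  have start: "s (?k - 1) \<le> t" using piece_start_le[OF k(2)] .
  have "enat (j - 1) < N" using pieces_pred_less[OF pieces_downward[OF k(1) j]] .
  then have "s 0 \<le> s (j - 1)" by (intro breakpoints_le[OF bp]) auto
  then have nonneg: "0 \<le> s (j - 1)" using bp by (simp add: breakpoints_def)
  have inner: "s (j - 1) \<le> s j" "s j \<le> t" "enat j \<noteq> N" if "j < ?k"
  proof -
    have jN: "enat j < N" using that last
      by (metis Suc_pred' enat_ord_simps(1) leD less_Suc_eq_le order.strict_trans1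
          not_less_zero gr_zeroI)
    then show "enat j \<noteq> N" by simp
    show "s (j - 1) \<le> s j" by (rule breakpoints_le[OF bp _ jN]) simp
    have "s j \<le> s (?k - 1)" using that by (intro breakpoints_le[OF bp _ last]) simp
    then show "s j \<le> t" using start by simp
  qed
  show "piece N s j \<inter> {0..t} =
      (if j < ?k then {s (j - 1)..<s j} else {s (j - 1)..t})"
  proof (cases "j < ?k")
    case True
    then show ?thesis using inner[OF True] nonneg by (auto simp: piece_def)
  next
    case False
    then have "j = ?k" using j by simp
    then show ?thesis using k(2) nonneg by (auto simp: piece_def split: if_splits)
  qed
  show "0 \<le> time_in_piece N s t j"
  proof (cases "j < ?k")
    case True
    then show ?thesis using inner(1) by (simp add: time_in_piece_def)
  next
    case False
    then have "j = ?k" using j by simp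
    then show ?thesis using start by (simp add: time_in_piece_def)
  qed
qed

lemma measure_piece_inter:
  assumes "breakpoints N s" "0 \<le> t" "1 \<le> j" "j \<le> piece_index N s t"
  shows "piece N s j \<inter> {0..t} \<in> sets lborel"
    and "emeasure lborel (piece N s j \<inter> {0..t}) = ennreal (time_in_piece N s t j)"
  using piece_inter_initial_interval[OF assms] by (auto simp: time_in_piece_def)

lemma voss_eq_sum:
  assumes "breakpoints N s" "0 \<le> t"
  shows "voss N s S t \<omega> = (\<Sum>j=1..piece_index N s t. S j (time_in_piece N s t j) \<omega>)"
proof -
  let ?k = "piece_index N s t"
  have "1 \<le> ?k" using piece_index(1)[OF assms] by (simp add: pieces_def)
  then have "{1..?k} = insert ?k {1..<?k}" by auto
  then show ?thesis by (simp add: voss_def Let_def time_in_piece_def add.commute)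
qed

text \<open>
  Every \<open>u\<close> in \<open>[0, t]\<close> lies in exactly one of the first \<open>piece_index N s t\<close> pieces, so the
  integrand is the corresponding combination of indicator functions, pointwise.
\<close>

lemma integral_powr_index:
  assumes \<alpha>: "piecewise_constant_index \<alpha> N s a" and t: "0 \<le> t"
  shows "(LINT u:{0..t}|lborel. l powr \<alpha> u) =
    (\<Sum>j=1..piece_index N s t. time_in_piece N s t j * l powr a j)"
proof -
  let ?k = "piece_index N s t" and ?J = "\<lambda>j. piece N s j \<inter> {0..t}"
  have bp: "breakpoints N s" using \<alpha> by (simp add: piecewise_constant_index_def)
  note k = piece_index[OF bp t]
  have step: "indicator {0..t} u *\<^sub>R l powr \<alpha> u =
      (\<Sum>j=1..?k. indicator (?J j) u *\<^sub>R l powr a j)" for u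
  proof (cases "u \<in> {0..t}")
    case False
    then show ?thesis by simp
  next
    case True
    let ?p = "piece_index N s u"
    have u: "0 \<le> u" "u \<le> t" using True by auto
    note p = piece_index[OF bp u(1)]
    have "?p \<in> {1..?k}" using p(1) piece_index_mono[OF bp u] by (simp add: pieces_def)
    moreover have "u \<in> ?J j \<longleftrightarrow> j = ?p" if "j \<in> {1..?k}" for j
      using piece_index_unique[OF bp u(1), of j] pieces_downward[OF k(1), of j] p True that
      by auto
    then have "(\<Sum>j=1..?k. indicator (?J j) u *\<^sub>R l powr a j) =
        (\<Sum>j=1..?k. if j = ?p then l powr a j else 0)"
      by (intro sum.cong) (auto simp: indicator_def)
    moreover have "\<alpha> u = a ?p" using \<alpha> p by (simp add: piecewise_constant_index_def)
    ultimately show ?thesis using True by simp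
  qed
  have piece_integral: "has_bochner_integral lborel (\<lambda>u. indicator (?J j) u *\<^sub>R l powr a j)
      (time_in_piece N s t j * l powr a j)" if "j \<in> {1..?k}" for j
  proof -
    have j: "1 \<le> j" "j \<le> ?k" using that by auto
    note J = measure_piece_inter[OF bp t j]
    have "has_bochner_integral lborel (\<lambda>u. indicator (?J j) u *\<^sub>R l powr a j)
        (measure lborel (?J j) *\<^sub>R l powr a j)"
      using J by (intro has_bochner_integral_indicator) auto
    moreover have "measure lborel (?J j) = time_in_piece N s t j"
      using J(2) piece_inter_initial_interval(2)[OF bp t j] by (simp add: measure_def)
    ultimately show ?thesis by simp
  qed
  show ?thesis
    unfolding set_lebesgue_integral_def step
    by (intro has_bochner_integral_integral_eq has_bochner_integral_sum piece_integral)
qed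

text \<open>
  Evaluation at a fixed time is measurable on the product space of paths, so independence of
  the paths passes to the variables \<open>exp (- l * S j (h j))\<close>, and expectation is multiplicative on
  them.
\<close>

lemma laplace_transform_sum:
  assumes S: "independent_stable_subordinators M N a S"
    and J: "finite J" "J \<subseteq> pieces N" and h: "\<And>j. j \<in> J \<Longrightarrow> 0 \<le> h j" and l: "0 \<le> l"
  shows "(LINT \<omega>|M. exp (- l * (\<Sum>j\<in>J. S j (h j) \<omega>))) =
    exp (- (\<Sum>j\<in>J. h j * l powr a j))"
proof -
  interpret prob_space M using S by (simp add: independent_stable_subordinators_def)
  have paths: "indep_vars (\<lambda>_. Pi\<^sub>M {0..} (\<lambda>_. borel)) (\<lambda>j \<omega>. \<lambda>t\<in>{0..}. S j t \<omega>) J"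
    using S J(2) by (auto simp: independent_stable_subordinators_def intro: indep_vars_subset)
  have "indep_vars (\<lambda>_. borel)
      (\<lambda>j \<omega>. (\<lambda>f. exp (- l * f (h j))) (\<lambda>t\<in>{0..}. S j t \<omega>)) J"
    using paths
  proof (rule indep_vars_compose2)
    fix j assume "j \<in> J"
    then have [measurable]: "(\<lambda>f. f (h j)) \<in> measurable (Pi\<^sub>M {0..} (\<lambda>_. borel)) (borel :: real measure)"
      using h by (intro measurable_component_singleton) simp
    show "(\<lambda>f. exp (- l * f (h j))) \<in> measurable (Pi\<^sub>M {0..} (\<lambda>_. borel)) borel"
      by measurable
  qed
  then have indep: "indep_vars (\<lambda>_. borel) (\<lambda>j \<omega>. exp (- l * S j (h j) \<omega>)) J"
    by (rule iffD1[OF indep_vars_cong, rotated -1]) (auto simp: h)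
  have transform: "(LINT \<omega>|M. exp (- l * S j (h j) \<omega>)) = exp (- h j * l powr a j)"
    if "j \<in> J" for j
    using S J(2) that h l
    by (auto simp: independent_stable_subordinators_def stable_subordinator_def)
  \<comment> \<open>A function that is not integrable has integral 0 by convention, while the transform is
    positive.\<close>
  have integrable: "integrable M (\<lambda>\<omega>. exp (- l * S j (h j) \<omega>))" if "j \<in> J" for j
    using transform[OF that] not_integrable_integral_eq by (metis exp_not_eq_zero)
  have "(LINT \<omega>|M. exp (- l * (\<Sum>j\<in>J. S j (h j) \<omega>))) =
      (LINT \<omega>|M. (\<Prod>j\<in>J. exp (- l * S j (h j) \<omega>)))"
    using J(1) by (simp add: sum_distrib_left exp_sum flip: sum_negf)
  also have "\<dots> = (\<Prod>j\<in>J. LINT \<omega>|M. exp (- l * S j (h j) \<omega>))"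
    using J(1) indep integrable by (rule indep_vars_lebesgue_integral)
  also have "\<dots> = (\<Prod>j\<in>J. exp (- h j * l powr a j))"
    using transform by (rule prod.cong[OF refl])
  also have "\<dots> = exp (- (\<Sum>j\<in>J. h j * l powr a j))"
    using J(1) by (simp add: exp_sum flip: sum_negf)
  finally show ?thesis .
qed

theorem proposition3p1:
  fixes M :: "'a measure"
    and \<alpha> :: "real \<Rightarrow> real"
    and N :: enat
    and s a :: "nat \<Rightarrow> real"
    and S :: "nat \<Rightarrow> real \<Rightarrow> 'a \<Rightarrow> real"
    and t l :: real
  assumes "piecewise_constant_index \<alpha> N s a"
    and "independent_stable_subordinators M N a S"
    and "0 \<le> t"
    and "0 \<le> l"
  shows "(LINT \<omega>|M. exp (- l * voss N s S t \<omega>)) = exp (- (LINT u:{0..t}|lborel. l powr \<alpha> u))"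
proof -
  have bp: "breakpoints N s" using assms(1) by (simp add: piecewise_constant_index_def)
  have "{1..piece_index N s t} \<subseteq> pieces N"
    using pieces_downward[OF piece_index(1)[OF bp assms(3)]] by auto
  then show ?thesis
    unfolding voss_eq_sum[OF bp assms(3)] integral_powr_index[OF assms(1,3)]
    using piece_inter_initial_interval(2)[OF bp assms(3)]
    by (intro laplace_transform_sum[OF assms(2) _ _ _ assms(4)]) auto
qed

end
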